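(* Let $f\in H^2(\mathcal U)$ be written as $$f(x+iy)=\frac1{\sqrt{2\pi}}\int_0^\infty g(t)e^{-yt}e^{ixt}\,dt,\qquad x+iy\in\mathcal U,$$ with $g\in L^2(\mathbb R)$, $\operatorname{supp}g\subseteq[0,+\infty)$. For $\varepsilon>0$ let $h=h_\varepsilon:\varepsilon\mathbb Z^2_+\to\mathbb C$ be $$h(\varepsilon m+i\varepsilon n)=\frac1{\sqrt{2\pi}}\int_0^{\pi/\varepsilon}g(t)\,e^{im\varepsilon t}\Big(\frac{\cos(\varepsilon t)}{1+\sin(\varepsilon t)}\Big)^n dt,\qquad m\in\mathbb Z,\ n\geqslant0.$$ Let $K\subseteq\mathcal U$ be compact. For $z=x+iy\in K$ set $$m_\varepsilon(z)=W\!\left(\frac x\varepsilon\right),\qquad n_\varepsilon(z)=W\!\left(\frac y\varepsilon\right),\qquad z_\varepsilon=\varepsilon m_\varepsilon(z)+i\varepsilon n_\varepsilon(z),$$ where $W(s)=\lfloor s+\frac12\rfloor$ for $s\in\mathbb R$. Then $$\lim_{\varepsilon\to0^+}\ \sup_{z\in K}|f(z)-h(z_\varepsilon)|=0.$$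
   Context: $\mathcal U=\{x+iy\in\mathbb C: y>0\}$ is the open upper half-plane and $H^2(\mathcal U)$ is the classical Hardy space on it; by the classical Paley--Wiener theorem every $f\in H^2(\mathcal U)$ has the stated integral representation. $\mathbb Z^2_+=\{m+in: m,n\in\mathbb Z,\ n\geqslant 0\}\subseteq\mathbb C$ and $\varepsilon\mathbb Z^2_+=\{\varepsilon z: z\in\mathbb Z^2_+\}$. *)

theory Defs
  imports "HOL-Analysis.Analysis"
begin

definition upper_half_plane :: "complex set" where
  "upper_half_plane = {z. Im z > 0}"

definition hardy_H2 :: "(complex \<Rightarrow> complex) set" where
  "hardy_H2 = {f. f holomorphic_on upper_half_plane \<and>
     (SUP y\<in>{0<..}. \<integral>\<^sup>+ x. ennreal ((cmod (f (Complex x y)))\<^sup>2) \<partial>lborel) < \<infinity>}"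

definition L2_real :: "(real \<Rightarrow> complex) set" where
  "L2_real = {g \<in> borel_measurable lebesgue. integrable lebesgue (\<lambda>t. (cmod (g t))\<^sup>2)}"

text \<open>
  The essential support, which depends only on the almost-everywhere class of \<open>g\<close>.
\<close>
definition ess_support :: "(real \<Rightarrow> complex) \<Rightarrow> real set" where
  "ess_support g = - \<Union>{V. open V \<and> (AE t in lebesgue. t \<in> V \<longrightarrow> g t = 0)}"

text \<open>
  Rounding is \<open>round s = \<lfloor>s + 1/2\<rfloor>\<close> (ties upwards).
\<close>
definition nearest_lattice_point :: "real \<Rightarrow> complex \<Rightarrow> complex" where
  "nearest_lattice_point \<epsilon> z =
     Complex (\<epsilon> * of_int (round (Re z / \<epsilon>))) (\<epsilon> * of_int (round (Im z / \<epsilon>)))"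

end

theory Submission
  imports Defs
begin

text \<open>
  Write \<open>\<phi> s = cos s / (1 + sin s)\<close> and let \<open>\<delta> \<le> Im z \<le> R\<close> on \<open>K\<close>. On \<open>[0, \<pi>/2]\<close> one has
  \<open>1 - s \<le> \<phi> s \<le> exp (- s)\<close>, so for \<open>\<epsilon> t \<le> \<pi>/2\<close> the kernel of \<open>h\<close> differs from that of \<open>f\<close> by
  \<open>O(\<epsilon> (t + t\<^sup>2))\<close> and by at most \<open>2 exp (- \<delta> t / 2)\<close>, uniformly in \<open>z \<in> K\<close>; dominated convergence
  applies to this part. On \<open>[\<pi>/2, \<pi>]\<close> the symmetry \<open>\<phi> (\<pi> - s) = - \<phi> s\<close> shows that the kernel of \<open>h\<close>
  grows back to modulus 1, but only as \<open>exp (- \<delta> (\<pi>/\<epsilon> - t) / 2)\<close>, whose \<open>L\<^sup>2\<close> norm is bounded in \<open>\<epsilon>\<close>,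
  whereas \<open>g\<close> has small \<open>L\<^sup>2\<close> norm on \<open>t > \<pi>/(2 \<epsilon>)\<close>. The product of the two is split by
  \<open>a e \<le> c a\<^sup>2 / 2 + e\<^sup>2 / (2 c)\<close>, choosing first \<open>c\<close> large and then \<open>\<epsilon>\<close> small.
\<close>

section \<open>Estimates for the decay factor on [0, pi]\<close>

definition decay_factor :: "real \<Rightarrow> real" where
  "decay_factor s = cos s / (1 + sin s)"

lemma decay_factor_nonneg:
  assumes "0 \<le> s" "s \<le> pi / 2"
  shows "0 \<le> decay_factor s"
  unfolding decay_factor_def using assms
  by (intro divide_nonneg_nonneg cos_ge_zero add_nonneg_nonneg sin_ge_zero) auto

text \<open>By sin^2 + cos^2 = 1 the numerator of the quotient rule collapses to -(1 + sin s). Both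
  monotonicity arguments below rest on this form.\<close>

lemma DERIV_decay_factor:
  assumes "0 \<le> s" "s \<le> pi / 2"
  shows "(decay_factor has_real_derivative - 1 / (1 + sin s)) (at s)"
proof -
  have pos: "1 + sin s > 0"
    using sin_ge_zero[of s] assms by linarith
  have "((\<lambda>s. cos s / (1 + sin s)) has_real_derivative
      (- sin s * (1 + sin s) - cos s * cos s) / ((1 + sin s) * (1 + sin s))) (at s)"
    using pos by (auto intro!: derivative_eq_intros)
  also have "- sin s * (1 + sin s) - cos s * cos s = - (1 + sin s)"
    using sin_cos_squared_add[of s] by (simp add: algebra_simps power2_eq_square)
  also have "- (1 + sin s) / ((1 + sin s) * (1 + sin s)) = - 1 / (1 + sin s)"
    using pos by (subst minus_divide_left[symmetric])+ (simp del: minus_add_distrib)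
  finally show ?thesis
    by (simp add: decay_factor_def[abs_def])
qed

text \<open>The product \<open>exp s * decay_factor s\<close> equals 1 at 0, and its derivative has
  the sign of cos s - 1.\<close>

lemma decay_factor_le_exp:
  assumes "0 \<le> s" "s \<le> pi / 2"
  shows "decay_factor s \<le> exp (- s)"
proof -
  let ?F = "\<lambda>s. exp s * decay_factor s"
  have "?F s \<le> ?F 0"
  proof (rule DERIV_nonpos_imp_nonincreasing[OF assms(1)])
    fix x assume x: "0 \<le> x" "x \<le> s"
    have pos: "1 + sin x > 0"
      using sin_ge_zero[of x] x assms by linarith
    have "(?F has_real_derivative exp x * decay_factor x + (- 1 / (1 + sin x)) * exp x) (at x)"
      using x assms by (intro DERIV_mult DERIV_exp DERIV_decay_factor) auto
    moreover have "exp x * decay_factor x + (- 1 / (1 + sin x)) * exp x =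
        exp x * ((cos x - 1) / (1 + sin x))"
      by (simp add: decay_factor_def diff_divide_distrib right_diff_distrib)
    moreover have "\<dots> \<le> 0"
      using pos by (intro mult_nonneg_nonpos divide_nonpos_pos) auto
    ultimately show "\<exists>y. (?F has_real_derivative y) (at x) \<and> y \<le> 0" by metis
  qed
  then have "exp s * decay_factor s \<le> 1" by (simp add: decay_factor_def)
  then show ?thesis by (simp add: exp_minus field_simps)
qed

text \<open>The derivative of \<open>decay_factor\<close> is at least -1 because sin is nonnegative
  here, and the value at 0 is 1.\<close>

lemma decay_factor_ge:
  assumes "0 \<le> s" "s \<le> pi / 2"
  shows "1 - s \<le> decay_factor s"
proof -
  let ?F = "\<lambda>s. decay_factor s + s"
  have "?F 0 \<le> ?F s"
  proof (rule DERIV_nonneg_imp_nondecreasing[OF assms(1)])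
    fix x assume x: "0 \<le> x" "x \<le> s"
    have "sin x \<ge> 0" using sin_ge_zero[of x] x assms by linarith
    then have "- 1 / (1 + sin x) + 1 \<ge> 0" by (simp add: field_simps)
    moreover have "(?F has_real_derivative - 1 / (1 + sin x) + 1) (at x)"
      using x assms by (intro DERIV_add DERIV_ident DERIV_decay_factor) auto
    ultimately show "\<exists>y. (?F has_real_derivative y) (at x) \<and> 0 \<le> y" by blast
  qed
  then show ?thesis by (simp add: decay_factor_def)
qed

text \<open>Both sides are compared with 1/(1 + s). Together with \<open>decay_factor_ge\<close>
  this gives a gap of at most s^2 between \<open>exp (- s)\<close> and
  \<open>decay_factor s\<close>.\<close>

lemma exp_minus_le_quadratic:
  fixes s :: real
  assumes "0 \<le> s"
  shows "exp (- s) \<le> 1 - s + s\<^sup>2"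
proof -
  have "exp (- s) \<le> 1 / (1 + s)"
    using exp_ge_add_one_self[of s] assms by (simp add: exp_minus field_simps)
  also have "\<dots> \<le> 1 - s + s\<^sup>2"
  proof -
    have "(1 - s + s\<^sup>2) * (1 + s) = 1 + s ^ 3"
      by (simp add: algebra_simps power2_eq_square power3_eq_cube)
    then show ?thesis using assms by (simp add: divide_le_eq)
  qed
  finally show ?thesis .
qed

lemma abs_decay_factor_le_exp:
  assumes "pi / 2 \<le> s" "s \<le> pi"
  shows "\<bar>decay_factor s\<bar> \<le> exp (- (pi - s))"
proof -
  have "decay_factor s = - decay_factor (pi - s)"
    by (simp add: decay_factor_def)
  then show ?thesis
    using decay_factor_le_exp[of "pi - s"] decay_factor_nonneg[of "pi - s"] assms by auto
qed

lemma abs_exp_minus_diff_le: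
  fixes a b :: real
  assumes "0 \<le> a" "0 \<le> b"
  shows "\<bar>exp (- a) - exp (- b)\<bar> \<le> \<bar>a - b\<bar>"
proof -
  have *: "exp (- a) - exp (- b) \<le> b - a" if "0 \<le> a" "a \<le> b" for a b :: real
  proof -
    have "exp (- a) - exp (- b) = exp (- a) * (1 - exp (- (b - a)))"
      by (simp add: algebra_simps flip: exp_add)
    also have "\<dots> \<le> 1 * (b - a)"
      using that exp_ge_add_one_self[of "a - b"] by (intro mult_mono) (auto simp: algebra_simps)
    finally show ?thesis by simp
  qed
  show ?thesis
    using *[of a b] *[of b a] assms by (cases "a \<le> b") auto
qed

text \<open>A chord of the unit circle is no longer than its arc; the chord is 2 |sin ((a - b) /
  2)|.\<close>

lemma norm_exp_i_diff_le:
  "norm (exp (\<i> * of_real a) - exp (\<i> * of_real b)) \<le> \<bar>a - b\<bar>"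
proof -
  have "exp (\<i> * of_real a) - exp (\<i> * of_real b) =
      exp (\<i> * of_real b) * (exp (\<i> * of_real (a - b)) - 1)"
    by (simp add: algebra_simps flip: exp_add)
  then have "norm (exp (\<i> * of_real a) - exp (\<i> * of_real b)) = 2 * \<bar>sin ((a - b) / 2)\<bar>"
    by (simp only: norm_mult norm_exp_i_times dist_exp_i_1 mult_1)
  also have "\<dots> \<le> \<bar>a - b\<bar>"
    using abs_sin_x_le_abs_x[of "(a - b) / 2"] by simp
  finally show ?thesis .
qed

section \<open>Pointwise bounds for the two kernels\<close>

text \<open>
  In \<open>\<epsilon> * (t + (R + 1) * t\<^sup>2)\<close>, the term \<open>\<epsilon> * t\<close> pays for rounding \<open>x\<close> and \<open>y\<close> by at most \<open>\<epsilon> / 2\<close>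
  each, and the rest is \<open>exp (- s) - decay_factor s \<le> s\<^sup>2\<close> at \<open>s = \<epsilon> * t\<close>, multiplied by the exponent
  \<open>n \<le> (R + 1) / \<epsilon>\<close>.
\<close>
definition lattice_error :: "real \<Rightarrow> real \<Rightarrow> real \<Rightarrow> real \<Rightarrow> real" where
  "lattice_error \<delta> R \<epsilon> t = min (\<epsilon> * (t + (R + 1) * t\<^sup>2)) (2 * exp (- (\<delta> / 2) * t))"

text \<open>Inserting the mixed term exp(-yt) exp(ix't) separates the phase error from the modulus
  error, which gives the first branch of the minimum. The second branch is the plain triangle
  inequality.\<close>

lemma low_frequency_bound:
  fixes n :: nat and \<epsilon> x x' y :: real
  assumes "0 < \<epsilon>" "\<epsilon> \<le> 1" "0 \<le> t" "\<epsilon> * t \<le> pi / 2"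
    and "\<bar>x - x'\<bar> \<le> \<epsilon> / 2" "\<bar>y - \<epsilon> * n\<bar> \<le> \<epsilon> / 2" "\<delta> \<le> y" "y \<le> R" "\<epsilon> \<le> \<delta>"
  shows "norm (of_real (exp (- y * t)) * exp (\<i> * of_real (x * t)) -
      exp (\<i> * of_real (x' * t)) * of_real (decay_factor (\<epsilon> * t) ^ n)) \<le> lattice_error \<delta> R \<epsilon> t"
proof -
  let ?s = "\<epsilon> * t"
  have s: "0 \<le> ?s" using assms by simp
  \<comment> \<open>Rounding costs at most half of \<epsilon>, which is at most \<delta>/2 below and
    at most 1 above.\<close>
  have y': "\<delta> / 2 \<le> \<epsilon> * n" "\<epsilon> * n \<le> R + 1"
    using assms by linarith+
  have d: "0 \<le> decay_factor ?s" "decay_factor ?s \<le> exp (- ?s)"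
    using assms s by (auto intro: decay_factor_nonneg decay_factor_le_exp)
  have en: "exp (- ?s) ^ n = exp (- (\<epsilon> * n * t))"
    by (simp add: mult.assoc mult.left_commute flip: exp_of_nat_mult)
  have "norm (of_real (exp (- y * t)) * exp (\<i> * of_real (x * t)) -
      exp (\<i> * of_real (x' * t)) * of_real (decay_factor ?s ^ n)) =
      norm (of_real (exp (- y * t)) * (exp (\<i> * of_real (x * t)) - exp (\<i> * of_real (x' * t))) +
      exp (\<i> * of_real (x' * t)) * of_real (exp (- y * t) - decay_factor ?s ^ n))"
    (is "?L = _")
    by (simp add: algebra_simps)
  also have "\<dots> \<le> exp (- y * t) * \<bar>x * t - x' * t\<bar> + \<bar>exp (- y * t) - decay_factor ?s ^ n\<bar>"
    by (intro norm_triangle_mono)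
      (simp_all only: norm_mult norm_of_real norm_exp_i_times mult_1 abs_exp_cancel order.refl
        mult_left_mono[OF norm_exp_i_diff_le exp_ge_zero])
  also have "\<dots> \<le> 1 * (\<epsilon> / 2 * t) + (\<epsilon> / 2 * t + (R + 1) * \<epsilon> * t\<^sup>2)"
  proof (intro add_mono mult_mono)
    show "\<bar>x * t - x' * t\<bar> \<le> \<epsilon> / 2 * t"
      using mult_right_mono[OF assms(5,3)] assms(3) by (simp add: abs_mult flip: left_diff_distrib)
    show "exp (- y * t) \<le> 1" using assms by simp
    have "\<bar>exp (- (y * t)) - exp (- (\<epsilon> * n * t))\<bar> \<le> \<bar>y * t - \<epsilon> * n * t\<bar>"
      using assms by (intro abs_exp_minus_diff_le) auto
    also have "\<dots> \<le> \<epsilon> / 2 * t"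
      using mult_right_mono[OF assms(6,3)] assms(3) by (simp add: abs_mult flip: left_diff_distrib)
    finally have 1: "\<bar>exp (- (y * t)) - exp (- (\<epsilon> * n * t))\<bar> \<le> \<epsilon> / 2 * t" .
    \<comment> \<open>Both bases lie in [0, 1], so the difference of the powers is at most n times
      the difference of the bases.\<close>
    have "\<bar>exp (- ?s) ^ n - decay_factor ?s ^ n\<bar> \<le> n * \<bar>exp (- ?s) - decay_factor ?s\<bar>"
      using norm_power_diff[of "exp (- ?s)" "decay_factor ?s" n] s d 
      by (simp add: order_trans[OF d(2)])
    also have "\<dots> \<le> n * ?s\<^sup>2"
      using exp_minus_le_quadratic[OF s] decay_factor_ge[OF s assms(4)] d
      by (intro mult_left_mono) auto
    \<comment> \<open>One of the two factors \<epsilon> is spent on n, since only the product of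
      \<epsilon> and n is bounded.\<close>
    also have "\<dots> = (\<epsilon> * n) * (\<epsilon> * t\<^sup>2)" by (simp add: power2_eq_square)
    also have "\<dots> \<le> (R + 1) * (\<epsilon> * t\<^sup>2)" using y' assms by (intro mult_right_mono) auto
    finally have "\<bar>exp (- (\<epsilon> * n * t)) - decay_factor ?s ^ n\<bar> \<le> (R + 1) * (\<epsilon> * t\<^sup>2)"
      unfolding en .
    with 1 have "\<bar>exp (- (y * t)) - decay_factor ?s ^ n\<bar> \<le> \<epsilon> / 2 * t + (R + 1) * (\<epsilon> * t\<^sup>2)"
      by (smt (verit, best))
    then show "\<bar>exp (- y * t) - decay_factor ?s ^ n\<bar> \<le> \<epsilon> / 2 * t + (R + 1) * \<epsilon> * t\<^sup>2"
      by (simp only: mult.assoc minus_mult_left)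
  qed (use assms in auto)
  also have "\<dots> = \<epsilon> * (t + (R + 1) * t\<^sup>2)" by (simp add: algebra_simps)
  finally have A: "?L \<le> \<epsilon> * (t + (R + 1) * t\<^sup>2)" .
  have "?L \<le> exp (- y * t) + decay_factor ?s ^ n"
    by (rule norm_triangle_le_diff)
      (use d in \<open>simp only: norm_mult norm_of_real norm_exp_i_times mult_1 abs_exp_cancel; simp\<close>)
  also have "decay_factor ?s ^ n \<le> exp (- (\<epsilon> * n * t))"
    unfolding en[symmetric] using d by (intro power_mono) auto
  also have "exp (- (\<epsilon> * n * t)) \<le> exp (- (\<delta> / 2) * t)"
    using mult_right_mono[OF y'(1) assms(3)] by simp
  also have "exp (- y * t) \<le> exp (- (\<delta> / 2) * t)"
    using mult_right_mono[of "\<delta> / 2" y t] assms by simp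
  finally have "?L \<le> 2 * exp (- (\<delta> / 2) * t)" by simp
  with A show ?thesis by (simp add: lattice_error_def)
qed

text \<open>Beyond the cutoff \<epsilon>t exceeds 1, so even the trivial bound 1 for the exponential
  lies below the first branch of the minimum.\<close>

lemma high_frequency_bound:
  assumes "0 < \<epsilon>" "0 \<le> t" "pi / 2 < \<epsilon> * t" "\<delta> \<le> y" "0 < \<delta>" "0 \<le> R"
  shows "exp (- y * t) \<le> lattice_error \<delta> R \<epsilon> t"
proof -
  have y: "0 \<le> y * t" using assms by simp
  have "\<delta> / 2 * t \<le> y * t" using assms by (intro mult_right_mono) auto
  then have "exp (- y * t) \<le> exp (- (\<delta> / 2) * t)" by simp
  also have "\<dots> \<le> 2 * exp (- (\<delta> / 2) * t)" by simp
  finally have A: "exp (- y * t) \<le> 2 * exp (- (\<delta> / 2) * t)" .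
  have "exp (- y * t) \<le> 1" using y by simp
  also have "1 \<le> \<epsilon> * t" using assms pi_gt3 by linarith
  also have "\<dots> \<le> \<epsilon> * (t + (R + 1) * t\<^sup>2)" using assms by (intro mult_left_mono) auto
  finally show ?thesis using A by (simp add: lattice_error_def)
qed

text \<open>The exponent n (pi - \<epsilon>t) is rewritten as \<epsilon>n (pi/\<epsilon> - t), where
  \<epsilon>n is at least \<delta>/2.\<close>

lemma abs_decay_factor_power_le:
  fixes n :: nat
  assumes "0 < \<epsilon>" "pi / 2 \<le> \<epsilon> * t" "\<epsilon> * t \<le> pi" "\<delta> / 2 \<le> \<epsilon> * n"
  shows "\<bar>decay_factor (\<epsilon> * t) ^ n\<bar> \<le> exp (- (\<delta> / 2) * (pi / \<epsilon> - t))"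
proof -
  have "\<bar>decay_factor (\<epsilon> * t) ^ n\<bar> \<le> exp (- (pi - \<epsilon> * t)) ^ n"
    unfolding power_abs using assms by (intro power_mono abs_decay_factor_le_exp) auto
  also have "\<dots> = exp (- (\<epsilon> * n * (pi / \<epsilon> - t)))"
    using assms(1) by (simp add: field_simps flip: exp_of_nat_mult)
  also have "\<dots> \<le> exp (- (\<delta> / 2) * (pi / \<epsilon> - t))"
    using mult_right_mono[OF assms(4), of "pi / \<epsilon> - t"] assms(1,3) by (simp add: field_simps)
  finally show ?thesis .
qed

section \<open>Exponential integrals and integrability against L2 functions\<close>

lemma has_bochner_integral_exp_minus:
  fixes a :: real
  assumes "0 < a"
  shows "has_bochner_integral lborel (\<lambda>t. indicator {0..} t * exp (- a * t)) (1 / a)"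
proof (rule has_bochner_integral_nn_integral)
  have "((\<lambda>t. - exp (- a * t) / a) \<longlongrightarrow> - 0 / a) at_top"
    using assms by (intro tendsto_intros filterlim_compose[OF exp_at_bot]
        filterlim_tendsto_neg_mult_at_bot[OF tendsto_const] filterlim_ident) auto
  then have "(\<integral>\<^sup>+ t. ennreal (exp (- a * t)) * indicator {0..} t \<partial>lborel) =
      - 0 / a - (- exp (- a * 0) / a)"
    using assms by (intro nn_integral_FTC_atLeast) (auto intro!: derivative_eq_intros)
  then show "(\<integral>\<^sup>+ t. ennreal (indicator {0..} t * exp (- a * t)) \<partial>lborel) = ennreal (1 / a)"
    by (simp add: ennreal_mult' ennreal_indicator mult.commute)
qed (use assms in auto)

text \<open>The value is independent of \<open>b\<close>. With \<open>b = pi / \<epsilon>\<close>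
  this bounds the reflected exponential uniformly in \<epsilon>.\<close>

lemma has_bochner_integral_exp_reflected:
  fixes a b :: real
  assumes "0 < a"
  shows "has_bochner_integral lborel (\<lambda>t. indicator {..b} t * exp (- a * (b - t))) (1 / a)"
proof -
  have "has_bochner_integral lborel
      (\<lambda>t. indicator {0..} (b + (- 1) * t) * exp (- a * (b + (- 1) * t))) ((1 / a) /\<^sub>R \<bar>- 1\<bar>)"
    using has_bochner_integral_exp_minus[OF assms]
    by (subst (asm) lborel_has_bochner_integral_real_affine_iff[where c = "- 1" and t = b]) auto
  moreover have "indicator {0..} (b + (- 1) * t) = (indicator {..b} t :: real)" for t
    by (auto simp: indicator_def)
  ultimately show ?thesis by simp
qed

text \<open>The exponential integrals are computed over \<open>lborel\<close>, whereas g is only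
  Lebesgue measurable; this carries them over to \<open>lebesgue\<close>.\<close>

lemma has_bochner_integral_completion:
  assumes "has_bochner_integral M f x" 
  shows "has_bochner_integral (completion M) f (x :: 'a :: {banach, second_countable_topology})"
  using assms by (auto simp: has_bochner_integral_iff integrable_completion integral_completion
      dest: borel_measurable_integrable)

lemma ident_borel_measurable_lebesgue [measurable]:
  "(\<lambda>t. t) \<in> borel_measurable (lebesgue :: real measure)"
  by (intro measurable_completion) simp

text \<open>The arithmetic-geometric mean inequality bounds the product by a sum of squares, both of
  which are integrable.\<close>

lemma integrable_exp_minus_times_L2:
  fixes a :: "real \<Rightarrow> real"
  assumes [measurable]: "a \<in> borel_measurable lebesgue"
    and a2: "integrable lebesgue (\<lambda>t. (a t)\<^sup>2)" and "0 < \<delta>"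
  shows "integrable lebesgue (\<lambda>t. indicator {0..} t * (a t * exp (- \<delta> * t)))"
proof (rule Bochner_Integration.integrable_bound)
  have "integrable lebesgue (\<lambda>t. indicator {0..} t * exp (- (2 * \<delta>) * t))"
    using has_bochner_integral_completion[OF has_bochner_integral_exp_minus[of "2 * \<delta>"]] assms(3)
    by (auto simp: has_bochner_integral_iff)
  then show "integrable lebesgue (\<lambda>t. (a t)\<^sup>2 + indicator {0..} t * exp (- (2 * \<delta>) * t))"
    using a2 by simp
  have "\<bar>a t * exp (- \<delta> * t)\<bar> \<le> (a t)\<^sup>2 + exp (- (2 * \<delta>) * t)" for t
  proof -
    have "2 * \<bar>a t\<bar> * exp (- \<delta> * t) \<le> \<bar>a t\<bar>\<^sup>2 + (exp (- \<delta> * t))\<^sup>2"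
      by (rule sum_squares_bound)
    moreover have "(exp (- \<delta> * t))\<^sup>2 = exp (- (2 * \<delta>) * t)"
      by (simp flip: exp_double)
    moreover have "0 \<le> \<bar>a t\<bar> * exp (- \<delta> * t)" by simp
    ultimately show ?thesis unfolding abs_mult abs_exp_cancel power2_abs by linarith
  qed
  then show "AE t in lebesgue. norm (indicator {0..} t * (a t * exp (- \<delta> * t)))
      \<le> norm ((a t)\<^sup>2 + indicator {0..} t * exp (- (2 * \<delta>) * t))"
    by (auto simp: indicator_def)
qed measurable

section \<open>The error integral and its limit\<close>

lemma lattice_error_measurable [measurable]:
  "lattice_error \<delta> R \<epsilon> \<in> borel_measurable borel"
  unfolding lattice_error_def[abs_def] by measurable

lemma lattice_error_nonneg:
  assumes "0 \<le> \<epsilon>" "0 \<le> R" "0 \<le> t"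
  shows "0 \<le> lattice_error \<delta> R \<epsilon> t"
  using assms by (simp add: lattice_error_def)

text \<open>The majorant does not contain \<epsilon>, so it can serve for dominated
  convergence.\<close>

lemma integrable_error_majorant:
  fixes a :: "real \<Rightarrow> real"
  assumes [measurable]: "a \<in> borel_measurable lebesgue"
    and "integrable lebesgue (\<lambda>t. (a t)\<^sup>2)" and "0 < \<delta>"
  shows "integrable lebesgue
    (\<lambda>t. indicator {0..} t * (\<bar>a t\<bar> * exp (- (\<delta> / 2) * t)) * 2 + \<bar>c\<bar> * (a t)\<^sup>2)"
  using integrable_exp_minus_times_L2[of "\<lambda>t. \<bar>a t\<bar>" "\<delta> / 2"] assms
  by (intro Bochner_Integration.integrable_add integrable_mult_left integrable_mult_right) auto

lemma abs_error_le_majorant: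
  fixes a :: "real \<Rightarrow> real"
  assumes "0 < \<epsilon>" "0 \<le> R"
  shows "\<bar>indicator {0..} t *
      (a t * lattice_error \<delta> R \<epsilon> t + c * (a t)\<^sup>2 * indicator {pi / (2 * \<epsilon>)<..} t)\<bar>
    \<le> indicator {0..} t * (\<bar>a t\<bar> * exp (- (\<delta> / 2) * t)) * 2 + \<bar>c\<bar> * (a t)\<^sup>2"
proof (cases "t \<ge> 0")
  case True
  have "\<bar>a t * lattice_error \<delta> R \<epsilon> t\<bar> \<le> \<bar>a t\<bar> * (2 * exp (- (\<delta> / 2) * t))"
    using lattice_error_nonneg[of \<epsilon> R t \<delta>] assms True
    unfolding abs_mult by (intro mult_left_mono) (auto simp: lattice_error_def)
  moreover have "\<bar>c * (a t)\<^sup>2 * indicator {pi / (2 * \<epsilon>)<..} t\<bar> \<le> \<bar>c\<bar> * (a t)\<^sup>2"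
    by (auto simp: indicator_def abs_mult)
  ultimately have "\<bar>a t * lattice_error \<delta> R \<epsilon> t + c * (a t)\<^sup>2 * indicator {pi / (2 * \<epsilon>)<..} t\<bar>
      \<le> \<bar>a t\<bar> * (2 * exp (- (\<delta> / 2) * t)) + \<bar>c\<bar> * (a t)\<^sup>2"
    by (rule order_trans[OF abs_triangle_ineq add_mono])
  with True show ?thesis by (simp add: mult_ac)
qed simp

lemma integrable_error:
  fixes a :: "real \<Rightarrow> real"
  assumes [measurable]: "a \<in> borel_measurable lebesgue"
    and "integrable lebesgue (\<lambda>t. (a t)\<^sup>2)" and "0 < \<delta>" and "0 < \<epsilon>" "0 \<le> R"
  shows "integrable lebesgue (\<lambda>t. indicator {0..} t *
      (a t * lattice_error \<delta> R \<epsilon> t + c * (a t)\<^sup>2 * indicator {pi / (2 * \<epsilon>)<..} t))"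
proof (rule Bochner_Integration.integrable_bound[OF integrable_error_majorant[OF assms(1-3), of c]])
  show "AE t in lebesgue. norm (indicator {0..} t *
      (a t * lattice_error \<delta> R \<epsilon> t + c * (a t)\<^sup>2 * indicator {pi / (2 * \<epsilon>)<..} t))
    \<le> norm (indicator {0..} t * (\<bar>a t\<bar> * exp (- (\<delta> / 2) * t)) * 2 + \<bar>c\<bar> * (a t)\<^sup>2)"
    unfolding real_norm_def
    by (intro AE_I2 order_trans[OF abs_error_le_majorant[OF assms(4,5)]] abs_ge_self)
qed measurable

lemma error_integral_tendsto_0:
  fixes a :: "real \<Rightarrow> real"
  assumes [measurable]: "a \<in> borel_measurable lebesgue"
    and "integrable lebesgue (\<lambda>t. (a t)\<^sup>2)" and "0 < \<delta>" and R: "0 \<le> R"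
  shows "((\<lambda>\<epsilon>. LINT t|lebesgue. indicator {0..} t *
      (a t * lattice_error \<delta> R \<epsilon> t + c * (a t)\<^sup>2 * indicator {pi / (2 * \<epsilon>)<..} t))
    \<longlongrightarrow> 0) (at_right 0)"
  \<comment> \<open>Dominated convergence is applied along sequences, so the one-sided limit is
    tested on positive null sequences.\<close>
  unfolding tendsto_at_iff_sequentially comp_def
proof (intro allI impI)
  fix X :: "nat \<Rightarrow> real"
  assume X: "\<forall>i. X i \<in> {0<..} - {0}" "X \<longlonglongrightarrow> 0"
  let ?E = "\<lambda>i t. indicator {0..} t *
      (a t * lattice_error \<delta> R (X i) t + c * (a t)\<^sup>2 * indicator {pi / (2 * X i)<..} t)"
  have pos: "X i > 0" for i using X by auto
  have lim: "(\<lambda>i. ?E i t) \<longlonglongrightarrow> 0" if t: "t \<ge> 0" for t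
  proof -
    have "(\<lambda>i. min (X i * (t + (R + 1) * t\<^sup>2)) (2 * exp (- (\<delta> / 2) * t)))
        \<longlonglongrightarrow> min (0 * (t + (R + 1) * t\<^sup>2)) (2 * exp (- (\<delta> / 2) * t))"
      by (intro tendsto_intros X)
    then have 1: "(\<lambda>i. lattice_error \<delta> R (X i) t) \<longlonglongrightarrow> 0"
      by (simp add: lattice_error_def)
    have "(\<lambda>i. X i * t) \<longlonglongrightarrow> 0 * t"
      by (intro tendsto_intros X)
    \<comment> \<open>For fixed t the cutoff pi/(2 X i) eventually passes t, and the tail indicator
      vanishes from then on.\<close>
    then have "eventually (\<lambda>i. X i * t < pi / 2) sequentially"
      by (intro order_tendstoD(2)[of _ "0 * t"]) auto
    then have 2: "eventually (\<lambda>i. indicator {pi / (2 * X i)<..} t = (0::real)) sequentially"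
    proof eventually_elim
      case (elim i)
      then show ?case using pos[of i] by (auto simp: indicator_def field_simps)
    qed
    have "(\<lambda>i. indicator {0..} t * (a t * lattice_error \<delta> R (X i) t
        + c * (a t)\<^sup>2 * indicator {pi / (2 * X i)<..} t)) \<longlonglongrightarrow> indicator {0..} t * (a t * 0 + c * (a t)\<^sup>2 * 0)"
      by (intro tendsto_intros 1 tendsto_eventually[OF 2])
    then show ?thesis by simp
  qed
  have "(\<lambda>i. integral\<^sup>L lebesgue (?E i)) \<longlonglongrightarrow> (LINT t|(lebesgue :: real measure). 0)"
  proof (rule integral_dominated_convergence)
    show "integrable lebesgue
        (\<lambda>t. indicator {0..} t * (\<bar>a t\<bar> * exp (- (\<delta> / 2) * t)) * 2 + \<bar>c\<bar> * (a t)\<^sup>2)"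
      by (rule integrable_error_majorant[OF assms(1-3)])
    show "AE t in lebesgue. (\<lambda>i. ?E i t) \<longlonglongrightarrow> 0"
    proof (rule AE_I2)
      fix t show "(\<lambda>i. ?E i t) \<longlonglongrightarrow> 0"
        using lim[of t] by (cases "t \<ge> 0") auto
    qed
    show "AE t in lebesgue. norm (?E i t)
        \<le> indicator {0..} t * (\<bar>a t\<bar> * exp (- (\<delta> / 2) * t)) * 2 + \<bar>c\<bar> * (a t)\<^sup>2" for i
      unfolding real_norm_def by (intro AE_I2 abs_error_le_majorant pos R)
  qed measurable
  then show "(\<lambda>i. integral\<^sup>L lebesgue (?E i)) \<longlonglongrightarrow> 0" by simp
qed

section \<open>Comparison of the two transforms\<close>

text \<open>Below the cutoff pi/(2\<epsilon>) the lattice error suffices. Above it the two kernels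
  are estimated separately: the lattice error absorbs that of f, and the remaining two terms absorb
  that of h. The reflected exponential is also kept for negative t, so that its integral is exactly
  1/\<delta>.\<close>

lemma kernel_difference_bound:
  fixes n :: nat and w :: complex and \<epsilon> x x' y :: real
  assumes eps: "0 < \<epsilon>" "\<epsilon> \<le> 1" "\<epsilon> \<le> \<delta>"
    and xy: "\<bar>x - x'\<bar> \<le> \<epsilon> / 2" "\<bar>y - \<epsilon> * n\<bar> \<le> \<epsilon> / 2" "\<delta> \<le> y" "y \<le> R" and c: "0 < c"
  shows "norm (indicator {0..} t *\<^sub>R (w * of_real (exp (- y * t)) * exp (\<i> * of_real (x * t))) -
      indicator {0..pi / \<epsilon>} t *\<^sub>R (w * exp (\<i> * of_real (x' * t)) * of_real (decay_factor (\<epsilon> * t) ^ n)))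
    \<le> indicator {0..} t * (norm w * lattice_error \<delta> R \<epsilon> t
        + c / 2 * (norm w)\<^sup>2 * indicator {pi / (2 * \<epsilon>)<..} t)
      + 1 / (2 * c) * (indicator {..pi / \<epsilon>} t * exp (- \<delta> * (pi / \<epsilon> - t)))"
    (is "norm (?F - ?H) \<le> ?A + ?B")
proof -
  have B: "0 \<le> ?B" using c by (auto simp: indicator_def)
  have \<delta>: "0 < \<delta>" and R: "0 \<le> R" using eps xy by linarith+
  consider "t < 0" | "0 \<le> t" "\<epsilon> * t \<le> pi / 2" | "0 \<le> t" "pi / 2 < \<epsilon> * t" by linarith
  then show ?thesis
  proof cases
    case 1
    then have zero: "?F = 0" "?H = 0" "?A = 0" by auto
    show ?thesis unfolding zero using B by simp
  next
    case 2
    have "\<epsilon> * t \<le> pi" using 2 pi_gt_zero by linarith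
    then have "t \<le> pi / (2 * \<epsilon>)" "t \<le> pi / \<epsilon>"
      using 2 eps by (auto simp: field_simps)
    with 2 have "?F - ?H = w * (of_real (exp (- y * t)) * exp (\<i> * of_real (x * t)) -
        exp (\<i> * of_real (x' * t)) * of_real (decay_factor (\<epsilon> * t) ^ n))"
      "?A = norm w * lattice_error \<delta> R \<epsilon> t"
      by (simp_all add: algebra_simps)
    then have "norm (?F - ?H) \<le> ?A"
      using low_frequency_bound[OF eps(1,2) 2 xy eps(3)]
      by (simp only: norm_mult mult_left_mono norm_ge_zero)
    with B show ?thesis by linarith
  next
    case 3
    have ind: "indicator {pi / (2 * \<epsilon>)<..} t = (1::real)"
      using 3 eps by (simp add: field_simps)
    have "norm ?F = norm w * exp (- y * t)"
      using 3 by (simp add: norm_mult)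
    also have "\<dots> \<le> norm w * lattice_error \<delta> R \<epsilon> t"
      using 3 eps xy \<delta> R by (intro mult_left_mono high_frequency_bound) auto
    finally have F: "norm ?F \<le> norm w * lattice_error \<delta> R \<epsilon> t" .
    have H: "norm ?H \<le> c / 2 * (norm w)\<^sup>2 + ?B"
    proof (cases "t \<le> pi / \<epsilon>")
      case True
      let ?e = "exp (- (\<delta> / 2) * (pi / \<epsilon> - t))"
      have "norm ?H = norm w * \<bar>decay_factor (\<epsilon> * t) ^ n\<bar>"
        using 3 True by (simp only: norm_mult norm_scaleR norm_exp_i_times norm_of_real) simp
      also have "\<dots> \<le> norm w * ?e"
      proof (intro mult_left_mono abs_decay_factor_power_le)
        show "\<epsilon> * t \<le> pi" using True eps(1) by (simp add: field_simps)
        show "\<delta> / 2 \<le> \<epsilon> * n" using eps xy by linarith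
      qed (use 3 eps in auto)
      also have "\<dots> \<le> c / 2 * (norm w)\<^sup>2 + 1 / (2 * c) * ?e\<^sup>2"
      proof -
        \<comment> \<open>Young's inequality with weight c, obtained by expanding a square.\<close>
        have "0 \<le> (c * norm w - ?e)\<^sup>2 / (2 * c)" using c by simp
        also have "\<dots> = c / 2 * (norm w)\<^sup>2 + 1 / (2 * c) * ?e\<^sup>2 - norm w * ?e"
          using c by (simp add: power2_diff field_simps power2_eq_square)
        finally show ?thesis by simp
      qed
      \<comment> \<open>Squaring doubles the rate \<delta>/2 to \<delta>.\<close>
      also have "?e\<^sup>2 = exp (- \<delta> * (pi / \<epsilon> - t))" by (simp flip: exp_double)
      finally show ?thesis using True by simp
    next
      case False
      then have zero: "?H = 0" by simp
      have "0 \<le> c / 2 * (norm w)\<^sup>2" using c by simp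
      with B show ?thesis unfolding zero norm_zero by (rule add_nonneg_nonneg[rotated])
    qed
    have "?A = norm w * lattice_error \<delta> R \<epsilon> t + c / 2 * (norm w)\<^sup>2"
      using 3(1) ind by simp
    then have "norm ?F + norm ?H \<le> ?A + ?B" using F H by linarith
    then show ?thesis by (rule order_trans[OF norm_triangle_ineq4])
  qed
qed

lemma transform_difference_bound:
  fixes n :: nat and \<epsilon> x x' y :: real and g :: "real \<Rightarrow> complex"
  assumes g [measurable]: "g \<in> borel_measurable lebesgue"
    and g2: "integrable lebesgue (\<lambda>t. (cmod (g t))\<^sup>2)"
    and eps: "0 < \<epsilon>" "\<epsilon> \<le> 1" "\<epsilon> \<le> \<delta>"
    and xy: "\<bar>x - x'\<bar> \<le> \<epsilon> / 2" "\<bar>y - \<epsilon> * n\<bar> \<le> \<epsilon> / 2" "\<delta> \<le> y" "y \<le> R" and c: "0 < c"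
  shows "cmod ((LINT t:{0..}|lebesgue. g t * of_real (exp (- y * t)) * exp (\<i> * of_real (x * t))) -
      (LINT t:{0..pi / \<epsilon>}|lebesgue. g t * exp (\<i> * of_real (x' * t)) * of_real (decay_factor (\<epsilon> * t) ^ n)))
    \<le> (LINT t|lebesgue. indicator {0..} t * (cmod (g t) * lattice_error \<delta> R \<epsilon> t
        + c / 2 * (cmod (g t))\<^sup>2 * indicator {pi / (2 * \<epsilon>)<..} t)) + 1 / (2 * c * \<delta>)"
proof -
  let ?F = "\<lambda>t. indicator {0..} t *\<^sub>R (g t * of_real (exp (- y * t)) * exp (\<i> * of_real (x * t)))"
  let ?H = "\<lambda>t. indicator {0..pi / \<epsilon>} t *\<^sub>R
      (g t * exp (\<i> * of_real (x' * t)) * of_real (decay_factor (\<epsilon> * t) ^ n))"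
  let ?A = "\<lambda>t. indicator {0..} t * (cmod (g t) * lattice_error \<delta> R \<epsilon> t
        + c / 2 * (cmod (g t))\<^sup>2 * indicator {pi / (2 * \<epsilon>)<..} t)"
  let ?B = "\<lambda>t. 1 / (2 * c) * (indicator {..pi / \<epsilon>} t * exp (- \<delta> * (pi / \<epsilon> - t)))"
  have \<delta>: "0 < \<delta>" and R: "0 \<le> R" using eps xy by linarith+
  have [measurable]: "?F \<in> borel_measurable lebesgue" "?H \<in> borel_measurable lebesgue"
    unfolding decay_factor_def by measurable
  have A: "integrable lebesgue ?A"
    using g2 \<delta> eps R by (intro integrable_error) auto
  have B: "has_bochner_integral lebesgue ?B (1 / (2 * c) * (1 / \<delta>))"
    by (intro has_bochner_integral_mult_right has_bochner_integral_completion
        has_bochner_integral_exp_reflected \<delta>)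
  have AB: "integrable lebesgue (\<lambda>t. ?A t + ?B t)"
    using A B by (intro Bochner_Integration.integrable_add) (auto simp: has_bochner_integral_iff)
  have le: "norm (?F t - ?H t) \<le> ?A t + ?B t" for t
    by (rule kernel_difference_bound[OF eps xy c])
  have FH: "integrable lebesgue (\<lambda>t. ?F t - ?H t)"
  proof (rule Bochner_Integration.integrable_bound[OF AB])
    show "AE t in lebesgue. norm (?F t - ?H t) \<le> norm (?A t + ?B t)"
      by (intro AE_I2 order_trans[OF le]) (simp only: real_norm_def abs_ge_self)
  qed measurable
  have F: "integrable lebesgue ?F"
  proof (rule Bochner_Integration.integrable_bound)
    show "integrable lebesgue (\<lambda>t. indicator {0..} t * (cmod (g t) * exp (- y * t)))"
      using g2 xy \<delta> by (intro integrable_exp_minus_times_L2) auto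
  qed (auto simp: norm_mult)
  \<comment> \<open>Integrability of \<open>?H\<close> is read off from
    \<open>?F - (?F - ?H)\<close>, as the difference is already dominated.\<close>
  have H: "integrable lebesgue ?H"
    using Bochner_Integration.integrable_diff[OF F FH] by simp
  have "cmod ((LINT t|lebesgue. ?F t) - (LINT t|lebesgue. ?H t)) = cmod (LINT t|lebesgue. ?F t - ?H t)"
    using F H by simp
  also have "\<dots> \<le> (LINT t|lebesgue. ?A t + ?B t)"
    by (rule Bochner_Integration.integral_norm_bound_integral[OF FH AB le])
  also have "\<dots> = integral\<^sup>L lebesgue ?A + integral\<^sup>L lebesgue ?B"
    using A B by (intro Bochner_Integration.integral_add) (auto simp: has_bochner_integral_iff)
  also have "integral\<^sup>L lebesgue ?B = 1 / (2 * c * \<delta>)"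
    using B by (simp add: has_bochner_integral_iff)
  finally show ?thesis by (simp only: set_lebesgue_integral_def)
qed

section \<open>Uniform convergence on the compact set\<close>

theorem corollary5p2:
  fixes f :: "complex \<Rightarrow> complex" and g :: "real \<Rightarrow> complex"
    and h :: "real \<Rightarrow> complex \<Rightarrow> complex" and K :: "complex set"
  assumes "f \<in> hardy_H2"
    and "g \<in> L2_real" and "ess_support g \<subseteq> {0..}"
    and "\<And>x y. y > 0 \<Longrightarrow>
      f (Complex x y) = of_real (1 / sqrt (2 * pi)) *
        (LINT t:{0..}|lebesgue. g t * of_real (exp (- y * t)) * exp (\<i> * of_real (x * t)))"
    and "\<And>\<epsilon> (m :: int) (n :: nat). \<epsilon> > 0 \<Longrightarrow>
      h \<epsilon> (Complex (\<epsilon> * of_int m) (\<epsilon> * of_nat n)) = of_real (1 / sqrt (2 * pi)) *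
        (LINT t:{0..pi / \<epsilon>}|lebesgue. g t * exp (\<i> * of_real (of_int m * \<epsilon> * t)) *
           of_real ((cos (\<epsilon> * t) / (1 + sin (\<epsilon> * t))) ^ n))"
    and "compact K" and "K \<subseteq> upper_half_plane"
  shows "((\<lambda>\<epsilon>. SUP z\<in>K. ennreal (cmod (f z - h \<epsilon> (nearest_lattice_point \<epsilon> z))))
          \<longlongrightarrow> 0) (at_right 0)"
proof (cases "K = {}")
  case True
  \<comment> \<open>The supremum over the empty set is the bottom element of \<open>ennreal\<close>,
    namely 0.\<close>
  then show ?thesis by (simp add: bot_ennreal)
next
  case False
  \<comment> \<open>Compactness confines K to a strip at positive distance from the real
    axis.\<close>
  obtain z0 where z0: "z0 \<in> K" "\<And>z. z \<in> K \<Longrightarrow> Im z0 \<le> Im z"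
    using continuous_attains_inf[OF assms(6) False continuous_on_Im[OF continuous_on_id]] by auto
  obtain z1 where z1: "z1 \<in> K" "\<And>z. z \<in> K \<Longrightarrow> Im z \<le> Im z1"
    using continuous_attains_sup[OF assms(6) False continuous_on_Im[OF continuous_on_id]] by auto
  define \<delta> R where "\<delta> = Im z0" and "R = Im z1"
  have \<delta>: "0 < \<delta>" using z0 assms(7) by (auto simp: \<delta>_def upper_half_plane_def)
  have R: "0 \<le> R" using z0(2)[OF z1(1)] \<delta> by (simp add: \<delta>_def R_def)
  have g: "g \<in> borel_measurable lebesgue" "integrable lebesgue (\<lambda>t. (cmod (g t))\<^sup>2)"
    using assms(2) by (auto simp: L2_real_def)
  define E where "E c \<epsilon> = (LINT t|lebesgue. indicator {0..} t *
      (cmod (g t) * lattice_error \<delta> R \<epsilon> t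
        + c / 2 * (cmod (g t))\<^sup>2 * indicator {pi / (2 * \<epsilon>)<..} t))" for c \<epsilon>
  \<comment> \<open>The right-hand side does not involve z, which is what makes the convergence
    uniform.\<close>
  have bound: "cmod (f z - h \<epsilon> (nearest_lattice_point \<epsilon> z)) \<le> E c \<epsilon> + 1 / (2 * c * \<delta>)"
    if z: "z \<in> K" and eps: "0 < \<epsilon>" "\<epsilon> \<le> 1" "\<epsilon> \<le> \<delta>" and c: "0 < c" for z \<epsilon> c
  proof -
    define m where "m = round (Re z / \<epsilon>)"
    define n where "n = nat (round (Im z / \<epsilon>))"
    have y: "\<delta> \<le> Im z" "Im z \<le> R"
      using z z0 z1 by (auto simp: \<delta>_def R_def)
    \<comment> \<open>Nonnegativity ensures that \<open>nat\<close> does not truncate, so the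
      formula for h at natural n applies.\<close>
    have "0 \<le> round (Im z / \<epsilon>)"
      using round_mono[of 0 "Im z / \<epsilon>"] y \<delta> eps by simp
    then have n: "real n = of_int (round (Im z / \<epsilon>))" by (simp add: n_def)
    have scale: "\<bar>u - \<epsilon> * of_int (round (u / \<epsilon>))\<bar> \<le> \<epsilon> / 2" for u
    proof -
      have "\<bar>u - \<epsilon> * of_int (round (u / \<epsilon>))\<bar> = \<bar>\<epsilon> * (of_int (round (u / \<epsilon>)) - u / \<epsilon>)\<bar>"
        using eps(1) by (subst abs_minus_commute) (simp add: algebra_simps)
      also have "\<dots> \<le> \<epsilon> * (1 / 2)"
        unfolding abs_mult abs_of_pos[OF eps(1)]
        using eps(1) by (intro mult_left_mono of_int_round_abs_le) auto
      finally show ?thesis by simp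
    qed
    let ?F = "LINT t:{0..}|lebesgue. g t * of_real (exp (- Im z * t)) * exp (\<i> * of_real (Re z * t))"
    let ?H = "LINT t:{0..pi / \<epsilon>}|lebesgue. g t * exp (\<i> * of_real (of_int m * \<epsilon> * t)) *
        of_real (decay_factor (\<epsilon> * t) ^ n)"
    have F: "f z = of_real (1 / sqrt (2 * pi)) * ?F"
      using assms(4)[of "Im z" "Re z"] y \<delta> by simp
    have H: "h \<epsilon> (nearest_lattice_point \<epsilon> z) = of_real (1 / sqrt (2 * pi)) * ?H"
      using assms(5)[OF eps(1), of m n]
      by (simp only: nearest_lattice_point_def n m_def decay_factor_def)
    have "f z - h \<epsilon> (nearest_lattice_point \<epsilon> z) = of_real (1 / sqrt (2 * pi)) * (?F - ?H)"
      unfolding F H right_diff_distrib ..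
    then have "cmod (f z - h \<epsilon> (nearest_lattice_point \<epsilon> z)) =
        \<bar>1 / sqrt (2 * pi)\<bar> * cmod (?F - ?H)"
      by (simp only: norm_mult norm_of_real)
    also have "\<dots> \<le> 1 * cmod (?F - ?H)"
      using pi_gt3 by (intro mult_right_mono) auto
    also have "cmod (?F - ?H) \<le> E c \<epsilon> + 1 / (2 * c * \<delta>)"
      unfolding E_def using scale[of "Re z"] scale[of "Im z"] y
      by (intro transform_difference_bound g eps c) (auto simp: m_def n mult.commute)
    finally show ?thesis by simp
  qed
  have E: "(E c \<longlongrightarrow> 0) (at_right 0)" for c
    unfolding E_def using error_integral_tendsto_0[of "\<lambda>t. cmod (g t)" \<delta> R "c / 2"] g \<delta> R by simp
  show ?thesis
  proof (rule order_tendstoI)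
    fix e :: ennreal assume "0 < e"
    \<comment> \<open>Since e may be infinite, a finite r strictly below it is chosen. The strict
      gap is needed because a supremum of values below r may equal r.\<close>
    then obtain r where r: "0 < ennreal r" "ennreal r < e" "0 < r"
      by (metis dense ennreal_cases ennreal_less_zero_iff infinity_ennreal_def not_less_iff_gr_or_eq top_greatest leD)
    \<comment> \<open>With this c the contribution of the reflected exponential is exactly r/2,
      leaving r/2 for the error integral.\<close>
    define c where "c = 1 / (\<delta> * r)"
    have c: "0 < c" "1 / (2 * c * \<delta>) = r / 2" using \<delta> r(3) by (auto simp: c_def)
    have "eventually (\<lambda>\<epsilon>. E c \<epsilon> < r / 2) (at_right 0)"
      by (rule order_tendstoD(2)[OF E]) (use r(3) in simp)
    moreover have "eventually (\<lambda>\<epsilon>. \<epsilon> \<in> {0<..<min 1 \<delta>}) (at_right 0)"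
      by (rule eventually_at_right_real) (use \<delta> in auto)
    ultimately show "eventually (\<lambda>\<epsilon>. (SUP z\<in>K. ennreal (cmod (f z - h \<epsilon> (nearest_lattice_point \<epsilon> z)))) < e)
        (at_right 0)"
    proof eventually_elim
      case (elim \<epsilon>)
      have "cmod (f z - h \<epsilon> (nearest_lattice_point \<epsilon> z)) \<le> r" if "z \<in> K" for z
        using bound[OF that _ _ _ c(1), of \<epsilon>, unfolded c(2)] elim by auto
      then have "(SUP z\<in>K. ennreal (cmod (f z - h \<epsilon> (nearest_lattice_point \<epsilon> z)))) \<le> ennreal r"
        by (intro SUP_least ennreal_leI)
      with r show ?case by order
    qed
  qed simp
qed

end
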